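(* Let $(\Omega,\mu,\sigma_0,\dots,\sigma_{N-1})$ be a system as described in the context, with associated $N$-to-$1$ map $\sigma:\Omega\to\Omega$, and define an endomorphism $\bar\sigma$ of $L^\infty(\Omega,\mu)$ by $(\bar\sigma f)(x)=f(\sigma(x))$. Let $s_i\mapsto S_i$ be a representation of the Cuntz algebra $\mathcal{O}_N$ on $L^2(\Omega,\mu)$. Then the following two conditions are equivalent: (i) There are functions $m_i\in L^\infty(\Omega)$, $i=0,\dots,N-1$, such that $(S_i\xi)(x)=m_i(x)\,\xi(\sigma(x))$ for all $\xi\in L^2(\Omega,\mu)$ and (almost all) $x\in\Omega$. (ii) $\sum_{i=0}^{N-1}S_iM_fS_i^*=M_{\bar\sigma(f)}$ for all $f\in L^\infty(\Omega)$, where $M_f$ is the operator of multiplication by $f$ on $L^2(\Omega,\mu)$. Furthermore, when these conditions are fulfilled, $m_i=S_i\mathbf{1}$, where $\mathbf 1$ is the constant function $1$.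
   Context: The Cuntz algebra $\mathcal{O}_N$ ($N\ge 2$) is the $C^*$-algebra generated by $s_0,\dots,s_{N-1}$ with $s_i^*s_j=\delta_{ij}1$ and $\sum_{i=0}^{N-1}s_is_i^*=1$; a representation $s_i\mapsto S_i$ on a Hilbert space is a family of operators satisfying the same relations. The system: $\Omega$ is a measure space, $\mu$ a probability measure on $\Omega$, and $\sigma_0,\dots,\sigma_{N-1}:\Omega\to\Omega$ are maps such that $\mu(\sigma_i(\Omega)\cap\sigma_j(\Omega))=0$ for $i\neq j$; with $\rho_i=\mu(\sigma_i(\Omega))$ one has $\rho_i>0$ and $\sum_{i=0}^{N-1}\rho_i=1$; $\mu(\sigma_i(Y))=\rho_i\,\mu(Y)$ for all $i$ and all measurable $Y\subset\Omega$ (equivalently $\int_\Omega f\,d\mu=\sum_{i}\rho_i\int_\Omega f\circ\sigma_i\,d\mu$ for all $f\in L^\infty(\Omega,\mu)$); and the sets $\sigma_{i_1}\sigma_{i_2}\cdots\sigma_{i_k}(\Omega)$ generate the $\sigma$-algebra of measurable sets up to null sets. The $\sigma_i$ are then injective up to measure zero, and $\sigma:\Omega\to\Omega$ is defined, up to measure zero, by $\sigma\circ\sigma_i=\mathrm{id}$ for all $i$. *)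

theory Defs
  imports "HOL-Probability.Probability"
begin

section \<open>The iterated function system\<close>

text \<open>For a word $w = [i_1, \ldots, i_k]$ this is
  $\tau_{i_1} \tau_{i_2} \cdots \tau_{i_k}(\Omega)$.\<close>

definition cylinder :: "'a measure \<Rightarrow> (nat \<Rightarrow> 'a \<Rightarrow> 'a) \<Rightarrow> nat list \<Rightarrow> 'a set" where
  "cylinder M \<tau> w = foldr (\<lambda>i A. \<tau> i ` A) w (space M)"

text \<open>The maps $\sigma_i$ are written \<open>\<tau> i\<close>, for \<open>i < N\<close>; values of \<open>\<tau>\<close> at other indices
  are irrelevant. Note that \<^const>\<open>measure\<close> assigns 0 to non-measurable sets, so measurability
  of the images has to be required separately. Measurability of the \<open>\<tau> i\<close> is what makes
  $f \circ \sigma_i$ a measurable function.\<close>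

locale branching_system = prob_space M
  for M :: "'a measure" +
  fixes N :: nat and \<tau> :: "nat \<Rightarrow> 'a \<Rightarrow> 'a"
  assumes N_ge_2: "N \<ge> 2"
    and branch_measurable: "\<And>i. i < N \<Longrightarrow> \<tau> i \<in> measurable M M"
    and branch_image_sets: "\<And>i Y. i < N \<Longrightarrow> Y \<in> sets M \<Longrightarrow> \<tau> i ` Y \<in> sets M"
    and branch_disjoint: "\<And>i j. i < N \<Longrightarrow> j < N \<Longrightarrow> i \<noteq> j \<Longrightarrow>
          measure M (\<tau> i ` space M \<inter> \<tau> j ` space M) = 0"
    and weight_pos: "\<And>i. i < N \<Longrightarrow> measure M (\<tau> i ` space M) > 0"
    and weight_sum: "(\<Sum>i<N. measure M (\<tau> i ` space M)) = 1"
    and branch_scaling: "\<And>i Y. i < N \<Longrightarrow> Y \<in> sets M \<Longrightarrow>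
          measure M (\<tau> i ` Y) = measure M (\<tau> i ` space M) * measure M Y"
    and cylinders_generate: "\<And>A. A \<in> sets M \<Longrightarrow>
          \<exists>B \<in> sigma_sets (space M) {cylinder M \<tau> w |w. w \<noteq> [] \<and> set w \<subseteq> {..<N}}.
            (A - B) \<union> (B - A) \<in> null_sets M"

text \<open>The map $\sigma$ is only determined up to null sets by $\sigma \circ \sigma_i = \mathrm{id}$;
  \<open>\<sigma>\<close> is any measurable representative.\<close>

locale branching_system_shift = branching_system M N \<tau>
  for M :: "'a measure" and N \<tau> +
  fixes \<sigma> :: "'a \<Rightarrow> 'a"
  assumes shift_measurable: "\<sigma> \<in> measurable M M"
    and shift_branch: "\<And>i. i < N \<Longrightarrow> AE x in M. \<sigma> (\<tau> i x) = x"

section \<open>Functions and operators modulo null sets\<close>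

text \<open>Elements of $L^2$ and $L^\infty$ are represented by functions, and equality in these spaces
  is equality almost everywhere. An operator on $L^2$ is represented by a map on representatives
  that is compatible with equality almost everywhere.\<close>

definition L2 :: "'a measure \<Rightarrow> ('a \<Rightarrow> complex) set" where
  "L2 M = {f \<in> borel_measurable M. integrable M (\<lambda>x. (cmod (f x))\<^sup>2)}"

definition Linfty :: "'a measure \<Rightarrow> ('a \<Rightarrow> complex) set" where
  "Linfty M = {f \<in> borel_measurable M. \<exists>C. AE x in M. cmod (f x) \<le> C}"

definition L2_inner :: "'a measure \<Rightarrow> ('a \<Rightarrow> complex) \<Rightarrow> ('a \<Rightarrow> complex) \<Rightarrow> complex" where
  "L2_inner M f g = (LINT x|M. f x * cnj (g x))"

definition L2_norm :: "'a measure \<Rightarrow> ('a \<Rightarrow> complex) \<Rightarrow> real" where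
  "L2_norm M f = sqrt (LINT x|M. (cmod (f x))\<^sup>2)"

definition bounded_operator ::
    "'a measure \<Rightarrow> (('a \<Rightarrow> complex) \<Rightarrow> 'a \<Rightarrow> complex) \<Rightarrow> bool" where
  "bounded_operator M T \<longleftrightarrow>
     (\<forall>f\<in>L2 M. T f \<in> L2 M) \<and>
     (\<forall>f\<in>L2 M. \<forall>g\<in>L2 M. (AE x in M. f x = g x) \<longrightarrow> (AE x in M. T f x = T g x)) \<and>
     (\<forall>f\<in>L2 M. \<forall>g\<in>L2 M. AE x in M. T (\<lambda>y. f y + g y) x = T f x + T g x) \<and>
     (\<forall>c. \<forall>f\<in>L2 M. AE x in M. T (\<lambda>y. c * f y) x = c * T f x) \<and>
     (\<exists>C. \<forall>f\<in>L2 M. L2_norm M (T f) \<le> C * L2_norm M f)"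

text \<open>The adjoint is unique up to equality almost everywhere, hence it is introduced as a
  relation.\<close>

definition is_adjoint ::
    "'a measure \<Rightarrow> (('a \<Rightarrow> complex) \<Rightarrow> 'a \<Rightarrow> complex) \<Rightarrow>
     (('a \<Rightarrow> complex) \<Rightarrow> 'a \<Rightarrow> complex) \<Rightarrow> bool" where
  "is_adjoint M T T' \<longleftrightarrow>
     bounded_operator M T' \<and>
     (\<forall>f\<in>L2 M. \<forall>g\<in>L2 M. L2_inner M (T f) g = L2_inner M f (T' g))"

definition mult_op :: "('a \<Rightarrow> complex) \<Rightarrow> ('a \<Rightarrow> complex) \<Rightarrow> 'a \<Rightarrow> complex" where
  "mult_op f \<xi> = (\<lambda>x. f x * \<xi> x)"

definition shift_endo :: "('a \<Rightarrow> 'a) \<Rightarrow> ('a \<Rightarrow> complex) \<Rightarrow> 'a \<Rightarrow> complex" where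
  "shift_endo \<sigma> f = (\<lambda>x. f (\<sigma> x))"

section \<open>Representations of the Cuntz algebra\<close>

text \<open>A representation of $\mathcal{O}_N$ on $L^2(\Omega, \mu)$ is given by the images \<open>S i\<close> of
  the generators, together with their adjoints \<open>S' i\<close>, for \<open>i < N\<close>.\<close>

definition cuntz_representation ::
    "'a measure \<Rightarrow> nat \<Rightarrow> (nat \<Rightarrow> ('a \<Rightarrow> complex) \<Rightarrow> 'a \<Rightarrow> complex) \<Rightarrow>
     (nat \<Rightarrow> ('a \<Rightarrow> complex) \<Rightarrow> 'a \<Rightarrow> complex) \<Rightarrow> bool" where
  "cuntz_representation M N S S' \<longleftrightarrow>
     (\<forall>i<N. bounded_operator M (S i) \<and> is_adjoint M (S i) (S' i)) \<and>
     (\<forall>i<N. \<forall>j<N. \<forall>\<xi>\<in>L2 M. AE x in M. S' i (S j \<xi>) x = (if i = j then \<xi> x else 0)) \<and>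
     (\<forall>\<xi>\<in>L2 M. AE x in M. (\<Sum>i<N. S i (S' i \<xi>) x) = \<xi> x)"

end

theory Submission
  imports Defs
begin

text \<open>The Cuntz relations turn (ii) into the intertwining relation
  $S_j M_f = M_{\bar\sigma(f)} S_j$ for $f \in L^\infty$. Applied to $\mathbf 1$ it gives (i) on
  $L^\infty$ with $m_j = S_j \mathbf 1$, and no density argument is needed to reach a general
  $\xi \in L^2$: for $f = 1/(1+|\xi|)$ both $f$ and $f\xi$ are bounded, so
  $\bar\sigma(f) \cdot S_j\xi = S_j(f\xi) = m_j \cdot \bar\sigma(f) \cdot (\xi \circ \sigma)$,
  and $\bar\sigma(f)$ has no zeros. Boundedness of $m_j$ follows from the isometry of $S_j$: for
  $B \subseteq \sigma_i(\Omega)$ and $Y = \sigma_i^{-1}(B)$ one has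
  $\int_B |m_j|^2 \le \|S_j 1_Y\|^2 = \mu(Y) = \mu(B)/\rho_i$, hence
  $|m_j|^2 \le 1/\rho_i$ on $\sigma_i(\Omega)$.\<close>

section \<open>Square-integrable functions, bounded multipliers and operators on
  representatives\<close>

lemma L2_D:
  assumes "f \<in> L2 M"
  shows "f \<in> borel_measurable M" "integrable M (\<lambda>x. (cmod (f x))\<^sup>2)"
  using assms by (auto simp: L2_def)

lemma mult_op_in_L2:
  assumes "f \<in> Linfty M" "\<xi> \<in> L2 M"
  shows "mult_op f \<xi> \<in> L2 M"
proof -
  from assms(1) obtain C where fm: "f \<in> borel_measurable M" and C: "AE x in M. cmod (f x) \<le> C"
    by (auto simp: Linfty_def)
  note xi = L2_D[OF assms(2)]
  have "integrable M (\<lambda>x. (cmod (f x * \<xi> x))\<^sup>2)"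
  proof (rule Bochner_Integration.integrable_bound)
    show "integrable M (\<lambda>x. C\<^sup>2 * (cmod (\<xi> x))\<^sup>2)"
      using xi by simp
    show "AE x in M. norm ((cmod (f x * \<xi> x))\<^sup>2) \<le> norm (C\<^sup>2 * (cmod (\<xi> x))\<^sup>2)"
      using C by eventually_elim
        (auto simp: norm_mult power_mult_distrib intro!: mult_right_mono power_mono)
  qed (use fm xi in measurable)
  then show ?thesis
    using fm xi by (auto simp: L2_def mult_op_def)
qed

lemma (in finite_measure) Linfty_subset_L2: "Linfty M \<subseteq> L2 M"
proof
  fix f assume f: "f \<in> Linfty M"
  have "(\<lambda>_. 1) \<in> L2 M"
    by (auto simp: L2_def)
  from mult_op_in_L2[OF f this] show "f \<in> L2 M"
    by (simp add: mult_op_def)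
qed

lemma Linfty_I:
  assumes "f \<in> borel_measurable M" "AE x in M. cmod (f x) \<le> C"
  shows "f \<in> Linfty M"
  using assms by (auto simp: Linfty_def)

lemma borel_measurable_cnj [measurable (raw)]:
  "f \<in> borel_measurable M \<Longrightarrow> (\<lambda>x. cnj (f x)) \<in> borel_measurable M"
  by (erule measurable_compose) (intro borel_measurable_continuous_onI continuous_on_cnj continuous_on_id)

lemma L2_inner_self: "L2_inner M f f = of_real (LINT x|M. (cmod (f x))\<^sup>2)"
  unfolding L2_inner_def complex_norm_square[symmetric] of_real_power[symmetric]
  by (rule integral_complex_of_real)

lemma bounded_operator_cong:
  assumes "bounded_operator M T" "f \<in> L2 M" "g \<in> L2 M" "AE x in M. f x = g x"
  shows "AE x in M. T f x = T g x"
  using assms unfolding bounded_operator_def by blast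

lemma bounded_operator_zero:
  assumes "bounded_operator M T"
  shows "AE x in M. T (\<lambda>_. 0) x = 0"
proof -
  have zero: "(\<lambda>_. 0) \<in> L2 M"
    by (simp add: L2_def)
  have "AE x in M. T (\<lambda>y. c * f y) x = c * T f x" if "f \<in> L2 M" for c f
    using assms that by (simp add: bounded_operator_def)
  from this[OF zero, of 0] show ?thesis by simp
qed

section \<open>Measure theory of the branches\<close>

context branching_system
begin

text \<open>Since the branch images overlap only in null sets, their measures add up, so their union
  has probability \<open>\<Sum>i<N. \<rho>\<^sub>i = 1\<close>.\<close>

lemma branches_cover: "AE x in M. \<exists>i<N. x \<in> \<tau> i ` space M"
proof -
  have sets: "\<tau> i ` space M \<in> sets M" if "i < N" for i
    using branch_image_sets[OF that] by blast
  have "pairwise (\<lambda>i j. AE x in M. x \<notin> \<tau> i ` space M \<or> x \<notin> \<tau> j ` space M) {..<N}"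
  proof (intro pairwiseI)
    fix i j assume ij: "i \<in> {..<N}" "j \<in> {..<N}" "i \<noteq> j"
    then have "\<tau> i ` space M \<inter> \<tau> j ` space M \<in> null_sets M"
      using branch_disjoint[of i j] sets by (auto simp: emeasure_eq_measure intro!: null_setsI)
    from AE_not_in[OF this] show "AE x in M. x \<notin> \<tau> i ` space M \<or> x \<notin> \<tau> j ` space M"
      by eventually_elim auto
  qed
  then have "prob (\<Union>i\<in>{..<N}. \<tau> i ` space M) = 1"
    using sets weight_sum by (subst measure_UNION_AE) (auto simp: fmeasurable_eq_sets)
  then have "AE x in M. x \<in> (\<Union>i\<in>{..<N}. \<tau> i ` space M)"
    by (rule AE_prob_1)
  then show ?thesis
    by eventually_elim auto
qed

text \<open>By the scaling law. This transports almost-everywhere statements about \<open>y\<close>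
  to the points \<open>\<tau> i y\<close> of the branch image.\<close>

lemma branch_image_null_sets:
  assumes "i < N" "Y \<in> null_sets M"
  shows "\<tau> i ` Y \<in> null_sets M"
proof (rule null_setsI)
  have Y: "Y \<in> sets M"
    using assms(2) by auto
  show "\<tau> i ` Y \<in> sets M"
    using branch_image_sets[OF assms(1) Y] .
  show "emeasure M (\<tau> i ` Y) = 0"
    using assms(2) branch_scaling[OF assms(1) Y] by (simp add: emeasure_eq_measure measure_eq_0_null_sets)
qed

end

context branching_system_shift
begin

text \<open>The exceptional set of \<open>\<sigma> (\<tau> i y) = y\<close> is null, and so is its
  image under \<open>\<tau> i\<close>. Off that image, every \<open>y\<close> with
  \<open>x = \<tau> i y\<close> satisfies \<open>\<sigma> x = y\<close>.\<close>

lemma shift_in_on_branch_image: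
  assumes i: "i < N" and Y: "Y \<in> sets M"
  shows "AE x in M. x \<in> \<tau> i ` Y \<longrightarrow> \<sigma> x \<in> Y"
proof -
  from shift_branch[OF i] obtain Z where Z: "Z \<in> null_sets M" "{x \<in> space M. \<sigma> (\<tau> i x) \<noteq> x} \<subseteq> Z"
    by (elim AE_E) (blast intro: null_setsI)
  from AE_not_in[OF branch_image_null_sets[OF i Z(1)]] show ?thesis
  proof eventually_elim
    case (elim x)
    show ?case
    proof
      assume "x \<in> \<tau> i ` Y"
      then obtain y where y: "y \<in> Y" "x = \<tau> i y"
        by blast
      with elim have "y \<notin> Z" by blast
      with y Z(2) sets.sets_into_space[OF Y] show "\<sigma> x \<in> Y" by auto
    qed
  qed
qed

text \<open>Assumption \<open>le\<close> says that the measure with density \<open>g\<close>, pushed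
  forward along \<open>\<sigma>\<close>, is dominated by \<open>M\<close>. It is tested on the
  preimage under \<open>\<tau> i\<close> of the set where the bound fails; taking this preimage
  multiplies the measure by \<open>1 / \<rho>\<close>.\<close>

lemma AE_le_inverse_weight:
  fixes g :: "'a \<Rightarrow> real"
  assumes i: "i < N" and g: "integrable M g" "\<And>x. g x \<ge> 0"
    and le: "\<And>Y. Y \<in> sets M \<Longrightarrow> (LINT x|M. indicator Y (\<sigma> x) * g x) \<le> measure M Y"
  shows "AE x in M. x \<in> \<tau> i ` space M \<longrightarrow> g x \<le> 1 / measure M (\<tau> i ` space M)"
proof -
  define \<rho> where "\<rho> = measure M (\<tau> i ` space M)"
  have \<rho>: "\<rho> > 0"
    using weight_pos[OF i] by (simp add: \<rho>_def)
  have gm [measurable]: "g \<in> borel_measurable M"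
    using g by auto
  note shift_measurable [measurable]
  have im [measurable]: "\<tau> i ` space M \<in> sets M"
    using branch_image_sets[OF i] by blast
  \<comment> \<open>The set where the bound fails; the goal is that it is null.\<close>
  define B where "B = {x \<in> space M. x \<in> \<tau> i ` space M \<and> g x > 1 / \<rho>}"
  have B [measurable]: "B \<in> sets M"
    unfolding B_def by measurable
  define Y where "Y = \<tau> i -` B \<inter> space M"
  have Y [measurable]: "Y \<in> sets M"
    unfolding Y_def using branch_measurable[OF i] B by (rule measurable_sets)
  have BY: "\<tau> i ` Y = B"
    by (auto simp: Y_def B_def)
  have intB: "integrable M (\<lambda>x. indicator B x * g x)"
    using integrable_mult_indicator[OF B g(1)] by simp
  have "integrable M (\<lambda>x. indicator (\<sigma> -` Y \<inter> space M) x *\<^sub>R g x)"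
    by (intro integrable_mult_indicator g) measurable
  then have intY: "integrable M (\<lambda>x. indicator Y (\<sigma> x) * g x)"
    by (rule Bochner_Integration.integrable_cong[THEN iffD1, rotated 2]) (auto simp: indicator_def)
  have "(LINT x|M. indicator B x * g x) \<le> (LINT x|M. indicator Y (\<sigma> x) * g x)"
  proof (rule integral_mono_AE[OF intB intY])
    show "AE x in M. indicator B x * g x \<le> indicator Y (\<sigma> x) * g x"
      using shift_in_on_branch_image[OF i Y] unfolding BY
      by eventually_elim (auto simp: indicator_def g(2))
  qed
  also have "\<dots> \<le> measure M Y"
    by (rule le[OF Y])
  also have "measure M Y = measure M B / \<rho>"
    using branch_scaling[OF i Y] \<rho> by (simp add: BY \<rho>_def)
  finally have le_B: "(LINT x|M. indicator B x * g x) \<le> measure M B / \<rho>" .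
  have intB': "integrable M (\<lambda>x. indicator B x * (1 / \<rho>))"
    using integrable_mult_indicator[OF B, of "\<lambda>_. 1 / \<rho>"] by simp
  \<comment> \<open>The excess of \<open>g\<close> over \<open>1 / \<rho>\<close> on
    \<open>B\<close>. It is nonnegative, and \<open>le_B\<close> says that its integral is at most
    0, so it vanishes almost everywhere; being strictly positive on \<open>B\<close>, it forces
    \<open>B\<close> to be null.\<close>
  define h where "h x = indicator B x * g x - indicator B x * (1 / \<rho>)" for x
  have int_h: "integrable M h"
    unfolding h_def using intB intB' by (intro Bochner_Integration.integrable_diff)
  have h_nonneg: "h x \<ge> 0" for x
    by (auto simp: h_def B_def indicator_def)
  have "integral\<^sup>L M h = (LINT x|M. indicator B x * g x) - measure M B / \<rho>"
    unfolding h_def using intB intB' B by (subst Bochner_Integration.integral_diff) auto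
  with le_B have "integral\<^sup>L M h = 0"
    using Bochner_Integration.integral_nonneg[of M h] h_nonneg by fastforce
  then have "AE x in M. h x = 0"
    using integral_nonneg_eq_0_iff_AE[OF int_h] h_nonneg by auto
  then show ?thesis
    using AE_space
  proof eventually_elim
    case (elim x)
    then have "x \<notin> B"
      by (auto simp: h_def B_def indicator_def)
    with elim show ?case
      by (auto simp: B_def \<rho>_def)
  qed
qed

text \<open>The bound from \<open>AE_le_inverse_weight\<close> depends on the branch, but finitely
  many branches cover almost everything.\<close>

lemma AE_bounded_if_shift_indicator_integral_le:
  fixes g :: "'a \<Rightarrow> real"
  assumes g: "integrable M g" "\<And>x. g x \<ge> 0"
    and le: "\<And>Y. Y \<in> sets M \<Longrightarrow> (LINT x|M. indicator Y (\<sigma> x) * g x) \<le> measure M Y"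
  shows "\<exists>C. AE x in M. g x \<le> C"
proof
  \<comment> \<open>The sum of these positive bounds dominates each of them and serves in place of
    their maximum.\<close>
  let ?C = "\<Sum>i<N. 1 / measure M (\<tau> i ` space M)"
  have "AE x in M. \<forall>i\<in>{..<N}. x \<in> \<tau> i ` space M \<longrightarrow> g x \<le> 1 / measure M (\<tau> i ` space M)"
    by (rule AE_finite_allI) (auto intro!: AE_le_inverse_weight assms)
  with branches_cover show "AE x in M. g x \<le> ?C"
  proof eventually_elim
    case (elim x)
    then obtain i where i: "i < N" "g x \<le> 1 / measure M (\<tau> i ` space M)"
      by auto
    note i(2)
    also have "1 / measure M (\<tau> i ` space M) \<le> ?C"
      by (rule member_le_sum) (use i in auto)
    finally show ?case .
  qed
qed

end

section \<open>Consequences of the Cuntz relations\<close>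

lemma cuntz_representation_D:
  assumes "cuntz_representation M N S S'" and i: "i < N"
  shows "bounded_operator M (S i)" "bounded_operator M (S' i)"
    "\<And>\<xi>. \<xi> \<in> L2 M \<Longrightarrow> S i \<xi> \<in> L2 M"
    "\<And>\<xi>. \<xi> \<in> L2 M \<Longrightarrow> S' i \<xi> \<in> L2 M"
    "\<And>j \<xi>. j < N \<Longrightarrow> \<xi> \<in> L2 M \<Longrightarrow> AE x in M. S' i (S j \<xi>) x = (if i = j then \<xi> x else 0)"
    "\<And>\<xi> \<eta>. \<xi> \<in> L2 M \<Longrightarrow> \<eta> \<in> L2 M \<Longrightarrow> L2_inner M (S i \<xi>) \<eta> = L2_inner M \<xi> (S' i \<eta>)"
    "\<And>\<xi>. \<xi> \<in> L2 M \<Longrightarrow> AE x in M. (\<Sum>i<N. S i (S' i \<xi>) x) = \<xi> x"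
proof -
  show T: "bounded_operator M (S i)" "bounded_operator M (S' i)"
    using assms by (simp_all add: cuntz_representation_def is_adjoint_def)
  show "S i \<xi> \<in> L2 M" "S' i \<xi> \<in> L2 M" if "\<xi> \<in> L2 M" for \<xi>
    using T that by (simp_all add: bounded_operator_def)
qed (use assms in \<open>simp_all add: cuntz_representation_def is_adjoint_def\<close>)

text \<open>Moving \<open>S i\<close> across the inner product leaves
  \<open>S' i (S i \<xi>)\<close>, which is \<open>\<xi>\<close> almost everywhere.\<close>

lemma cuntz_isometry:
  assumes C: "cuntz_representation M N S S'" and i: "i < N" and \<xi>: "\<xi> \<in> L2 M"
  shows "(LINT x|M. (cmod (S i \<xi> x))\<^sup>2) = (LINT x|M. (cmod (\<xi> x))\<^sup>2)"
proof -
  note D = cuntz_representation_D[OF C i]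
  note [measurable] = L2_D(1)[OF \<xi>] L2_D(1)[OF D(4)[OF D(3)[OF \<xi>]]]
  have "L2_inner M (S i \<xi>) (S i \<xi>) = L2_inner M \<xi> (S' i (S i \<xi>))"
    using D \<xi> by blast
  also have "\<dots> = L2_inner M \<xi> \<xi>"
    unfolding L2_inner_def
  proof (rule integral_cong_AE)
    show "AE x in M. \<xi> x * cnj (S' i (S i \<xi>) x) = \<xi> x * cnj (\<xi> x)"
      using D(5)[OF i \<xi>] by eventually_elim simp
  qed measurable
  finally show ?thesis
    unfolding L2_inner_self of_real_eq_iff .
qed

text \<open>Condition (ii) is applied to the vector \<open>S j \<eta>\<close>: by orthogonality of
  the generators only the term \<open>i = j\<close> of the sum survives, and there
  \<open>S' j (S j \<eta>)\<close> is \<open>\<eta>\<close>.\<close>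

lemma cuntz_intertwining:
  assumes C: "cuntz_representation M N S S'"
    and ii: "\<And>f \<xi>. f \<in> Linfty M \<Longrightarrow> \<xi> \<in> L2 M \<Longrightarrow>
      AE x in M. (\<Sum>i<N. S i (mult_op f (S' i \<xi>)) x) = mult_op (shift_endo \<sigma> f) \<xi> x"
    and j: "j < N" and f: "f \<in> Linfty M" and \<eta>: "\<eta> \<in> L2 M"
  shows "AE x in M. S j (mult_op f \<eta>) x = f (\<sigma> x) * S j \<eta> x"
proof -
  note D = cuntz_representation_D[OF C]
  have S\<eta>: "S j \<eta> \<in> L2 M"
    using D(3)[OF j \<eta>] .
  have "AE x in M. \<forall>i\<in>{..<N}.
      S i (mult_op f (S' i (S j \<eta>))) x = (if i = j then S j (mult_op f \<eta>) x else 0)"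
  proof (rule AE_finite_allI)
    fix i assume "i \<in> {..<N}"
    then have i: "i < N" by simp
    have L2: "mult_op f (S' i (S j \<eta>)) \<in> L2 M"
      using f D(4)[OF i S\<eta>] by (rule mult_op_in_L2)
    show "AE x in M. S i (mult_op f (S' i (S j \<eta>))) x = (if i = j then S j (mult_op f \<eta>) x else 0)"
    proof (cases "i = j")
      case True
      have "AE x in M. mult_op f (S' i (S j \<eta>)) x = mult_op f \<eta> x"
        using D(5)[OF i j \<eta>] by eventually_elim (simp add: True mult_op_def)
      from bounded_operator_cong[OF D(1)[OF i] L2 mult_op_in_L2[OF f \<eta>] this] show ?thesis
        using True by simp
    next
      case False
      have "AE x in M. mult_op f (S' i (S j \<eta>)) x = 0"
        using D(5)[OF i j \<eta>] by eventually_elim (simp add: False mult_op_def)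
      \<comment> \<open>The argument of \<open>S i\<close> vanishes only almost everywhere, so it is
        first replaced by the zero function, which a linear operator annihilates.\<close>
      from bounded_operator_cong[OF D(1)[OF i] L2 _ this] bounded_operator_zero[OF D(1)[OF i]]
      show ?thesis
        using False by (auto simp: L2_def)
    qed
  qed simp
  with ii[OF f S\<eta>] show ?thesis
    by eventually_elim (use j in \<open>auto simp: mult_op_def shift_endo_def\<close>)
qed

section \<open>From the intertwining relation to weighted shifts\<close>

context branching_system_shift
begin

text \<open>A priori \<open>S j (\<lambda>_. 1)\<close> is only square integrable. Intertwining on
  indicator functions and the isometry property show that its squared modulus satisfies the
  domination hypothesis of \<open>AE_bounded_if_shift_indicator_integral_le\<close>, even with
  equality.\<close>

lemma image_of_one_in_Linfty:
  assumes C: "cuntz_representation M N S S'" and j: "j < N"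
    and inter: "\<And>f. f \<in> Linfty M \<Longrightarrow> AE x in M. S j f x = f (\<sigma> x) * S j (\<lambda>_. 1) x"
  shows "S j (\<lambda>_. 1) \<in> Linfty M"
proof -
  define m where "m = S j (\<lambda>_. 1)"
  have "(\<lambda>_. 1) \<in> L2 M"
    by (auto simp: L2_def)
  note m = L2_D[OF cuntz_representation_D(3)[OF C j this], folded m_def]
  note [measurable] = m(1) shift_measurable
  have "\<exists>K. AE x in M. (cmod (m x))\<^sup>2 \<le> K"
  proof (rule AE_bounded_if_shift_indicator_integral_le[OF m(2)])
    fix Y assume Y [measurable]: "Y \<in> sets M"
    let ?f = "\<lambda>x. indicator Y x :: complex"
    have f: "?f \<in> Linfty M"
      by (rule Linfty_I[where C = 1]) (auto simp: indicator_def)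
    then have f2: "?f \<in> L2 M"
      using Linfty_subset_L2 by blast
    note [measurable] = L2_D(1)[OF cuntz_representation_D(3)[OF C j f2]]
    have "(LINT x|M. indicator Y (\<sigma> x) * (cmod (m x))\<^sup>2) = (LINT x|M. (cmod (S j ?f x))\<^sup>2)"
    proof (rule integral_cong_AE)
      show "AE x in M. indicator Y (\<sigma> x) * (cmod (m x))\<^sup>2 = (cmod (S j ?f x))\<^sup>2"
        using inter[OF f, folded m_def] by eventually_elim (auto simp: indicator_def)
    qed measurable
    also have "\<dots> = (LINT x|M. (cmod (?f x))\<^sup>2)"
      by (rule cuntz_isometry[OF C j f2])
    also have "\<dots> = (LINT x|M. indicator Y x)"
      by (rule Bochner_Integration.integral_cong) (auto simp: indicator_def)
    also have "\<dots> = measure M Y"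
      using Y by simp
    finally show "(LINT x|M. indicator Y (\<sigma> x) * (cmod (m x))\<^sup>2) \<le> measure M Y"
      by simp
  qed simp
  then obtain K where "AE x in M. (cmod (m x))\<^sup>2 \<le> K" by blast
  then have "AE x in M. cmod (m x) \<le> sqrt K"
    by eventually_elim (rule real_le_rsqrt)
  then show ?thesis
    unfolding m_def[symmetric] by (rule Linfty_I[OF m(1)])
qed

text \<open>The function \<open>mult_op f \<xi>\<close> is read in two ways, as the multiplier
  \<open>f\<close> acting on \<open>\<xi>\<close> and as a bounded multiplier acting on the constant
  1. Comparing the two values of \<open>T\<close> and cancelling \<open>f (\<sigma> x)\<close> gives
  the formula.\<close>

lemma weighted_shift_if_intertwining:
  assumes inter: "\<And>f \<eta>. f \<in> Linfty M \<Longrightarrow> \<eta> \<in> L2 M \<Longrightarrow>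
      AE x in M. T (mult_op f \<eta>) x = f (\<sigma> x) * T \<eta> x"
    and \<xi>: "\<xi> \<in> L2 M"
  shows "AE x in M. T \<xi> x = T (\<lambda>_. 1) x * \<xi> (\<sigma> x)"
proof -
  note [measurable] = L2_D(1)[OF \<xi>]
  define f where "f x = complex_of_real (1 / (1 + cmod (\<xi> x)))" for x
  have f_nz: "f x \<noteq> 0" for x
    unfolding f_def of_real_eq_0_iff using norm_ge_zero[of "\<xi> x"] by (simp add: add_nonneg_eq_0_iff)
  have norm_f: "cmod (f x) = 1 / (1 + cmod (\<xi> x))" for x
    unfolding f_def norm_of_real by simp
  have f: "f \<in> Linfty M"
  proof (rule Linfty_I[where C = 1])
    show "f \<in> borel_measurable M"
      unfolding f_def by measurable
    show "AE x in M. cmod (f x) \<le> 1"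
      unfolding norm_f by (simp add: divide_simps add_pos_nonneg)
  qed
  have g: "mult_op f \<xi> \<in> Linfty M"
  proof (rule Linfty_I[where C = 1])
    show "mult_op f \<xi> \<in> borel_measurable M"
      unfolding mult_op_def f_def by measurable
    have "cmod (f x * \<xi> x) \<le> 1" for x
      unfolding norm_mult norm_f by (simp add: divide_simps add_pos_nonneg)
    then show "AE x in M. cmod (mult_op f \<xi> x) \<le> 1"
      by (simp add: mult_op_def)
  qed
  have "(\<lambda>_. 1) \<in> L2 M"
    by (auto simp: L2_def)
  from inter[OF g this] inter[OF f \<xi>] show ?thesis
  proof eventually_elim
    case (elim x)
    have "f (\<sigma> x) * T \<xi> x = T (mult_op f \<xi>) x"
      using elim(2) by simp
    also have "\<dots> = f (\<sigma> x) * (T (\<lambda>_. 1) x * \<xi> (\<sigma> x))"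
      using elim(1) by (simp add: mult_op_def mult_ac)
    finally show ?case
      using f_nz[of "\<sigma> x"] by simp
  qed
qed

end

section \<open>Equivalence of the two conditions and uniqueness of the weights\<close>

theorem proposition1p1:
  fixes M :: "'a measure" and N :: nat
    and \<tau> :: "nat \<Rightarrow> 'a \<Rightarrow> 'a" and \<sigma> :: "'a \<Rightarrow> 'a"
    and S S' :: "nat \<Rightarrow> ('a \<Rightarrow> complex) \<Rightarrow> 'a \<Rightarrow> complex"
  assumes "branching_system_shift M N \<tau> \<sigma>"
    and "cuntz_representation M N S S'"
  shows "((\<exists>m. \<forall>i<N. m i \<in> Linfty M \<and>
              (\<forall>\<xi>\<in>L2 M. AE x in M. S i \<xi> x = m i x * \<xi> (\<sigma> x)))
          \<longleftrightarrow>
          (\<forall>f\<in>Linfty M. \<forall>\<xi>\<in>L2 M. AE x in M.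
              (\<Sum>i<N. S i (mult_op f (S' i \<xi>)) x) = mult_op (shift_endo \<sigma> f) \<xi> x))
       \<and> (\<forall>m. (\<forall>i<N. m i \<in> Linfty M \<and>
              (\<forall>\<xi>\<in>L2 M. AE x in M. S i \<xi> x = m i x * \<xi> (\<sigma> x)))
            \<longrightarrow> (\<forall>i<N. AE x in M. m i x = S i (\<lambda>_. 1) x))"
proof -
  interpret branching_system_shift M N \<tau> \<sigma> by fact
  note C = assms(2)
  note D = cuntz_representation_D[OF C]
  have one: "(\<lambda>_. 1) \<in> L2 M"
    by (auto simp: L2_def)
  let ?i = "\<lambda>m. \<forall>i<N. m i \<in> Linfty M \<and> (\<forall>\<xi>\<in>L2 M. AE x in M. S i \<xi> x = m i x * \<xi> (\<sigma> x))"
  let ?ii = "\<forall>f\<in>Linfty M. \<forall>\<xi>\<in>L2 M. AE x in M.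
              (\<Sum>i<N. S i (mult_op f (S' i \<xi>)) x) = mult_op (shift_endo \<sigma> f) \<xi> x"
  \<comment> \<open>A weighted shift turns multiplication by \<open>f\<close> into multiplication by
    \<open>f (\<sigma> x)\<close>. This factor is the same for all \<open>i\<close>, so it leaves
    the sum, and the remaining sum is \<open>\<xi>\<close> by the Cuntz relations.\<close>
  have "?ii" if m: "?i m" for m
  proof (intro ballI)
    fix f \<xi> assume f: "f \<in> Linfty M" and \<xi>: "\<xi> \<in> L2 M"
    have "AE x in M. \<forall>i\<in>{..<N}. S i (mult_op f (S' i \<xi>)) x = f (\<sigma> x) * S i (S' i \<xi>) x"
    proof (rule AE_finite_allI)
      fix i assume "i \<in> {..<N}"
      then have i: "i < N" by simp
      have "AE x in M. S i (mult_op f (S' i \<xi>)) x = m i x * mult_op f (S' i \<xi>) (\<sigma> x)"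
        using m i mult_op_in_L2[OF f D(4)[OF i \<xi>]] by blast
      moreover have "AE x in M. S i (S' i \<xi>) x = m i x * S' i \<xi> (\<sigma> x)"
        using m i D(4)[OF i \<xi>] by blast
      ultimately show "AE x in M. S i (mult_op f (S' i \<xi>)) x = f (\<sigma> x) * S i (S' i \<xi>) x"
        by eventually_elim (simp add: mult_op_def)
    qed simp
    moreover have "AE x in M. (\<Sum>i<N. S i (S' i \<xi>) x) = \<xi> x"
      \<comment> \<open>Index 0 is admissible because \<open>N \<ge> 2\<close>.\<close>
      using D(7)[OF _ \<xi>, of 0] N_ge_2 by simp
    ultimately show "AE x in M. (\<Sum>i<N. S i (mult_op f (S' i \<xi>)) x)
        = mult_op (shift_endo \<sigma> f) \<xi> x"
      by eventually_elim (simp add: mult_op_def shift_endo_def flip: sum_distrib_left)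
  qed
  moreover have "\<exists>m. ?i m" if ii: "?ii"
  \<comment> \<open>The witness is forced: putting the constant 1 for \<open>\<xi>\<close> in (i)
    leaves \<open>m i\<close> alone, as the constant 1 is invariant under composition with
    \<open>\<sigma>\<close>.\<close>
  proof (rule exI[of _ "\<lambda>i. S i (\<lambda>_. 1)"], intro allI impI)
    fix j assume j: "j < N"
    have inter: "AE x in M. S j (mult_op f \<eta>) x = f (\<sigma> x) * S j \<eta> x"
      if "f \<in> Linfty M" "\<eta> \<in> L2 M" for f \<eta>
      using cuntz_intertwining[OF C _ j that] ii by blast
    have "S j (\<lambda>_. 1) \<in> Linfty M"
      using inter[OF _ one] by (intro image_of_one_in_Linfty[OF C j]) (simp add: mult_op_def)
    with weighted_shift_if_intertwining[of "S j", OF inter]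
    show "S j (\<lambda>_. 1) \<in> Linfty M \<and>
        (\<forall>\<xi>\<in>L2 M. AE x in M. S j \<xi> x = S j (\<lambda>_. 1) x * \<xi> (\<sigma> x))"
      by blast
  qed
  moreover have "AE x in M. m i x = S i (\<lambda>_. 1) x" if "?i m" "i < N" for m i
  proof -
    have "AE x in M. S i (\<lambda>_. 1) x = m i x * 1"
      using that one by blast
    then show ?thesis
      by eventually_elim simp
  qed
  ultimately show ?thesis
    by (intro conjI iffI) (elim exE | blast)+
qed

end
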